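(* Let $n\ge3$ be odd and let $$W_n=\Big\{\lambda_i+\lambda_{n+1-i}: i\in\{1,\dots,\lfloor\tfrac{n+1}{4}\rfloor\}\Big\}.$$ Let $\gamma=\frac12\sum_{i=1}^n\min(i,n+1-i)\,\alpha_i$ and $\psi=2\rho-\gamma$. Then every $\mu\in W_n$ satisfies $\frac{n+1}{2}\in I(\mu)\cap I'(\mu)$, where $$I(\mu)=\Big\{i:\tfrac{\mu(\tilde\beta_i)}{2\rho(\tilde\beta_i)}=\min_{1\le j\le n}\tfrac{\mu(\tilde\beta_j)}{2\rho(\tilde\beta_j)}\Big\},\qquad I'(\mu)=\Big\{i:\tfrac{\mu(\tilde\beta_i)}{\psi(\tilde\beta_i)}=\min_{1\le j\le n}\tfrac{\mu(\tilde\beta_j)}{\psi(\tilde\beta_j)}\Big\}.$$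
   Context: $\mathfrak a$ is the space of real traceless diagonal $(n+1)\times(n+1)$ matrices $H=\mathrm{diag}(h_1,\dots,h_{n+1})$ (the Cartan subalgebra of $\mathfrak{sl}(n+1,\mathbb{R})$); simple roots $\alpha_i(H)=h_i-h_{i+1}$; $\tilde\beta_1,\dots,\tilde\beta_n\in\mathfrak a$ with $\alpha_i(\tilde\beta_j)=\delta_{ij}$; fundamental weights $\lambda_i(H)=h_1+\dots+h_i$; $\rho=\sum_i\lambda_i$ is half the sum of positive roots. The functional $\gamma$ equals Oh's functional ($n$ odd): $\frac12(\sum_{i=1}^{(n-1)/2}i\alpha_i+\sum_{i=(n+1)/2}^n(n+1-i)\alpha_i)$. *)

theory Defs
  imports Complex_Main "Jordan_Normal_Form.Matrix"
begin

text \<open>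
  Linear functionals are functions on all real matrices; only their values on the
  Cartan subalgebra matter. Matrix entries are indexed from 0,
  so the diagonal entry \<open>h_i\<close>, \<open>1 \<le> i \<le> n + 1\<close>, is \<open>H $$ (i - 1, i - 1)\<close>.
\<close>

definition cartan :: "nat \<Rightarrow> real mat set" where
  "cartan n = {H \<in> carrier_mat (n + 1) (n + 1). diagonal_mat H \<and> (\<Sum>i<n + 1. H $$ (i, i)) = 0}"

definition diag_entry :: "nat \<Rightarrow> real mat \<Rightarrow> real" where
  "diag_entry i H = H $$ (i - 1, i - 1)"

definition simple_root :: "nat \<Rightarrow> real mat \<Rightarrow> real" where
  "simple_root i H = diag_entry i H - diag_entry (i + 1) H"

definition fund_weight :: "nat \<Rightarrow> real mat \<Rightarrow> real" where
  "fund_weight i H = (\<Sum>k = 1..i. diag_entry k H)"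

text \<open>The basis of the Cartan subalgebra dual to the simple roots; see \<open>beta_unique\<close> for well-definedness.\<close>

definition beta :: "nat \<Rightarrow> nat \<Rightarrow> real mat" where
  "beta n j = (THE H. H \<in> cartan n \<and> (\<forall>i\<in>{1..n}. simple_root i H = (if i = j then 1 else 0)))"

definition rho :: "nat \<Rightarrow> real mat \<Rightarrow> real" where
  "rho n H = (\<Sum>i = 1..n. fund_weight i H)"

definition gamma :: "nat \<Rightarrow> real mat \<Rightarrow> real" where
  "gamma n H = 1 / 2 * (\<Sum>i = 1..n. real (min i (n + 1 - i)) * simple_root i H)"

definition psi :: "nat \<Rightarrow> real mat \<Rightarrow> real" where
  "psi n H = 2 * rho n H - gamma n H"

definition W :: "nat \<Rightarrow> (real mat \<Rightarrow> real) set" where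
  "W n = {(\<lambda>H. fund_weight i H + fund_weight (n + 1 - i) H) | i. i \<in> {1..(n + 1) div 4}}"

definition I_set :: "nat \<Rightarrow> (real mat \<Rightarrow> real) \<Rightarrow> nat set" where
  "I_set n \<mu> = {i \<in> {1..n}. \<mu> (beta n i) / (2 * rho n (beta n i)) =
     Min ((\<lambda>j. \<mu> (beta n j) / (2 * rho n (beta n j))) ` {1..n})}"

definition I'_set :: "nat \<Rightarrow> (real mat \<Rightarrow> real) \<Rightarrow> nat set" where
  "I'_set n \<mu> = {i \<in> {1..n}. \<mu> (beta n i) / psi n (beta n i) =
     Min ((\<lambda>j. \<mu> (beta n j) / psi n (beta n j)) ` {1..n})}"

lemma rho_half_sum_pos_roots:
  assumes "H \<in> cartan n"
  shows "rho n H = 1 / 2 * (\<Sum>j = 1..n + 1. \<Sum>i = 1..<j. diag_entry i H - diag_entry j H)"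
proof -
  have "(\<Sum>j = 1..m + 1. \<Sum>i = 1..<j. diag_entry i H - diag_entry j H) =
      2 * rho m H - real m * fund_weight (m + 1) H" for m
  proof (induction m)
    case 0
    show ?case by (simp add: rho_def)
  next
    case (Suc m)
    have S: "(\<Sum>i = 1..<Suc m + 1. diag_entry i H - diag_entry (Suc m + 1) H) =
        fund_weight (Suc m) H - real (Suc m) * diag_entry (Suc m + 1) H"
      by (simp add: sum_subtractf fund_weight_def atLeastLessThanSuc_atLeastAtMost)
    have F: "fund_weight (Suc m + 1) H = fund_weight (Suc m) H + diag_entry (Suc m + 1) H"
      by (simp add: fund_weight_def)
    have R: "rho (Suc m) H = rho m H + fund_weight (Suc m) H"
      by (simp add: rho_def)
    have "(\<Sum>j = 1..Suc m + 1. \<Sum>i = 1..<j. diag_entry i H - diag_entry j H) =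
        (\<Sum>j = 1..m + 1. \<Sum>i = 1..<j. diag_entry i H - diag_entry j H) +
        (\<Sum>i = 1..<Suc m + 1. diag_entry i H - diag_entry (Suc m + 1) H)"
      by (simp only: Suc_eq_plus1 sum.nat_ivl_Suc' add_Suc[symmetric] sum.cl_ivl_Suc) simp
    also have "\<dots> = 2 * rho (Suc m) H - real (Suc m) * fund_weight (Suc m + 1) H"
      unfolding Suc.IH S F R by (simp add: algebra_simps)
    finally show ?case .
  qed
  moreover have "fund_weight (n + 1) H = (\<Sum>i<n + 1. H $$ (i, i))"
    unfolding fund_weight_def diag_entry_def
    by (rule sum.reindex_bij_witness[where i = Suc and j = "\<lambda>i. i - 1"]) auto
  ultimately show ?thesis
    using assms by (simp add: cartan_def)
qed

lemma beta_unique: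
  assumes "j \<in> {1..n}"
  shows "\<exists>!H. H \<in> cartan n \<and> (\<forall>i\<in>{1..n}. simple_root i H = (if i = j then 1 else 0))"
proof (rule ex_ex1I)
  define c where "c = real j / real (n + 1)"
  define H where "H = mat (n + 1) (n + 1) (\<lambda>(k, l). if k = l then (if k < j then 1 else 0) - c else 0)"
  have "(\<Sum>i<n + 1. H $$ (i, i)) = (\<Sum>i<n + 1. (if i < j then 1 else 0) - c)"
    by (rule sum.cong) (auto simp: H_def)
  also have "\<dots> = (\<Sum>i<n + 1. if i < j then 1 else 0) - real (n + 1) * c"
    by (simp add: sum_subtractf)
  also have "(\<Sum>i<n + 1. if i < j then 1 else (0::real)) = (\<Sum>i\<in>{..<j}. 1)"
    by (rule sum.mono_neutral_cong_right) (use assms in auto)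
  finally have "(\<Sum>i<n + 1. H $$ (i, i)) = 0"
    by (simp add: c_def)
  moreover have "H \<in> carrier_mat (n + 1) (n + 1)" "diagonal_mat H"
    by (auto simp: H_def diagonal_mat_def)
  moreover have "\<forall>i\<in>{1..n}. simple_root i H = (if i = j then 1 else 0)"
    using assms by (auto simp: simple_root_def diag_entry_def H_def)
  ultimately show "\<exists>H. H \<in> cartan n \<and> (\<forall>i\<in>{1..n}. simple_root i H = (if i = j then 1 else 0))"
    by (auto simp: cartan_def)
next
  fix A B
  assume A: "A \<in> cartan n \<and> (\<forall>i\<in>{1..n}. simple_root i A = (if i = j then 1 else 0))"
    and B: "B \<in> cartan n \<and> (\<forall>i\<in>{1..n}. simple_root i B = (if i = j then 1 else 0))"
  define d where "d k = A $$ (k, k) - B $$ (k, k)" for k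
  have step: "d (Suc k) = d k" if "k < n" for k
  proof -
    have "simple_root (Suc k) A = simple_root (Suc k) B"
      using A B that by auto
    then show ?thesis
      by (simp add: simple_root_def diag_entry_def d_def)
  qed
  have const: "d k = d 0" if "k \<le> n" for k
    using that by (induction k) (auto simp: step)
  have "0 = (\<Sum>k<n + 1. d k)"
    using A B by (simp add: cartan_def d_def sum_subtractf)
  also have "\<dots> = (\<Sum>k<n + 1. d 0)"
    by (rule sum.cong[OF refl], rule const) simp
  finally have "d 0 = 0"
    by (simp del: sum.lessThan_Suc)
  then have "d k = 0" if "k \<le> n" for k
    using const[OF that] by simp
  then have diag: "A $$ (k, k) = B $$ (k, k)" if "k \<le> n" for k
    using that by (simp add: d_def)
  show "A = B"
  proof (rule eq_matI)
    fix k l assume "k < dim_row B" "l < dim_col B"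
    then show "A $$ (k, l) = B $$ (k, l)"
      using A B diag by (cases "k = l") (auto simp: cartan_def diagonal_mat_def)
  qed (use A B in \<open>auto simp: cartan_def\<close>)
qed

end

theory Submission
  imports Defs
begin

text \<open>
  Put \<open>N = n + 1 = 2 k\<close> and \<open>m = min j (N - j)\<close>. On the dual basis,
  \<open>\<lambda>\<^sub>i + \<lambda>\<^bsub>N-i\<^esub>\<close> takes the value \<open>min i m\<close>, \<open>2 \<rho>\<close> the value \<open>m (2 k - m)\<close> and \<open>\<gamma>\<close> the
  value \<open>m / 2\<close>. Both claims then say that \<open>min i m / (m (2 k - m - c))\<close> is minimal at
  \<open>m = k\<close>, for \<open>c = 0\<close> and \<open>c = 1 / 2\<close>. For \<open>m \<ge> i\<close> the denominator is maximal at \<open>m = k\<close>;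
  for \<open>m < i\<close> the claim reduces to \<open>i (2 k - m - c) \<le> k (k - c)\<close>, which follows from
  \<open>2 i \<le> k\<close> and \<open>m \<ge> 1\<close>.
\<close>

lemma simple_root_beta:
  assumes "j \<in> {1..n}" "i \<in> {1..n}"
  shows "simple_root i (beta n j) = (if i = j then 1 else 0)"
  using theI'[OF beta_unique[OF assms(1)]] assms(2) unfolding beta_def by blast

lemma fund_weight_cartan:
  assumes "H \<in> cartan n"
  shows "fund_weight (n + 1) H = 0"
proof -
  have "fund_weight (n + 1) H = (\<Sum>i<n + 1. H $$ (i, i))"
    unfolding fund_weight_def diag_entry_def
    by (rule sum.reindex_bij_witness[where i = Suc and j = "\<lambda>i. i - 1"]) auto
  then show ?thesis
    using assms by (simp add: cartan_def)
qed

text \<open>The simple roots fix the differences of consecutive diagonal entries: the diagonal of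
  \<open>beta n j\<close> is constant up to position j and drops by 1 after it. The vanishing trace
  then fixes its first entry d.\<close>

lemma fund_weight_beta:
  assumes j: "j \<in> {1..n}" and "i \<le> n + 1"
  shows "fund_weight i (beta n j) = real (min i j) - real i * real j / real (n + 1)"
proof -
  define d where "d = diag_entry 1 (beta n j)"
  have diag: "diag_entry (Suc k) (beta n j) = d - (if k < j then 0 else 1)" if "k \<le> n" for k
    using that
  proof (induction k)
    case 0
    then show ?case using j by (simp add: d_def)
  next
    case (Suc k)
    then show ?case
      using simple_root_beta[OF j, of "Suc k"] by (auto simp: simple_root_def split: if_splits)
  qed
  have fw: "fund_weight k (beta n j) = real k * d - (real k - real (min k j))" if "k \<le> n + 1" for k
    using that
  proof (induction k)
    case 0
    then show ?case by (simp add: fund_weight_def)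
  next
    case (Suc k)
    then have "fund_weight (Suc k) (beta n j) =
        real k * d - (real k - real (min k j)) + (d - (if k < j then 0 else 1))"
      using diag[of k] by (simp add: fund_weight_def)
    then show ?case
      by (auto simp: min_def algebra_simps)
  qed
  have "beta n j \<in> cartan n"
    using theI'[OF beta_unique[OF j]] unfolding beta_def by blast
  then have "real (n + 1) * d = real (n + 1) - real j"
    using fw[of "n + 1"] fund_weight_cartan[of "beta n j" n] j by (simp add: min_def)
  then have d: "d = 1 - real j / real (n + 1)"
    by (simp add: field_simps)
  show ?thesis
    unfolding fw[OF assms(2)] d by (simp add: right_diff_distrib)
qed

lemma sum_min:
  "(\<Sum>i = 1..m. real (min i j)) =
    (if m \<le> j then real m * (real m + 1) / 2 else real j * (2 * real m + 1 - real j) / 2)"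
proof (induction m)
  case (Suc m)
  then show ?case
    \<comment> \<open>The two branches agree at \<open>m = j\<close>, where the induction passes
      from one to the other.\<close>
    by (cases "m = j") (auto simp: min_def field_simps)
qed simp

lemma rho_beta:
  assumes j: "j \<in> {1..n}"
  shows "2 * rho n (beta n j) = real j * (real (n + 1) - real j)"
proof -
  have "rho n (beta n j) = (\<Sum>i = 1..n. real (min i j) - real i * (real j / real (n + 1)))"
    unfolding rho_def by (rule sum.cong) (auto simp: fund_weight_beta[OF j])
  also have "\<dots> = (\<Sum>i = 1..n. real (min i j)) - (\<Sum>i = 1..n. real i) * (real j / real (n + 1))"
    by (simp only: sum_subtractf sum_distrib_right)
  also have "(\<Sum>i = 1..n. real i) = real n * real (n + 1) / 2"
    by (induction n) (auto simp: field_simps)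
  also have "(\<Sum>i = 1..n. real (min i j)) = real j * (2 * real n + 1 - real j) / 2"
    unfolding sum_min using j by (auto simp: field_simps)
  also have "real n * real (n + 1) / 2 * (real j / real (n + 1)) = real n * real j / 2"
  proof -
    have "a * N / 2 * (b / N) = a * b / 2" if "N \<noteq> 0" for a b N :: real
      using that by simp
    from this[of "real (n + 1)"] show ?thesis
      by (metis of_nat_eq_0_iff add_is_0 one_neq_zero)
  qed
  finally show ?thesis
    by (simp add: algebra_simps diff_divide_distrib)
qed

lemma gamma_beta:
  assumes j: "j \<in> {1..n}"
  shows "gamma n (beta n j) = real (min j (n + 1 - j)) / 2"
proof -
  have "(\<Sum>i = 1..n. real (min i (n + 1 - i)) * simple_root i (beta n j)) =
      (\<Sum>i = 1..n. if i = j then real (min i (n + 1 - i)) else 0)"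
    by (rule sum.cong) (auto simp: simple_root_beta[OF j])
  also have "\<dots> = real (min j (n + 1 - j))"
    using j by simp
  finally show ?thesis
    by (simp add: gamma_def)
qed

text \<open>The correction terms of \<open>fund_weight_beta\<close> add up to j, since the two
  indices sum to \<open>n + 1\<close>. The rest is a trapezoid in j: it equals j for
  \<open>j \<le> i\<close>, then i up to \<open>n + 1 - i\<close>, then
  \<open>n + 1 - j\<close>.\<close>

lemma fund_weight_pair_beta:
  assumes "j \<in> {1..n}" "2 * i \<le> n + 1"
  shows "fund_weight i (beta n j) + fund_weight (n + 1 - i) (beta n j) =
    real (min i (min j (n + 1 - j)))"
proof -
  have "real i * real j + real (n + 1 - i) * real j = real j * real (n + 1)"
    using assms by (simp add: of_nat_diff algebra_simps)
  then have "real i * real j / real (n + 1) + real (n + 1 - i) * real j / real (n + 1) = real j"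
    by (simp flip: add_divide_distrib)
  moreover have "real (min i j) + real (min (n + 1 - i) j) - real j =
      real (min i (min j (n + 1 - j)))"
    using assms by (auto simp: min_def of_nat_diff)
  ultimately show ?thesis
    using assms fund_weight_beta[of j n i] fund_weight_beta[of j n "n + 1 - i"] by simp
qed

lemma ratio_min:
  fixes i m k :: nat and c :: real
  assumes "1 \<le> m" "m \<le> k" "2 * i \<le> k" "0 \<le> c" "c < 1"
  shows "real i / (real k * (real k - c)) \<le> real (min i m) / (real m * (2 * real k - real m - c))"
proof -
  have pos: "real k * (real k - c) > 0" "real m * (2 * real k - real m - c) > 0"
    using assms by auto
  have "real i * (real m * (2 * real k - real m - c)) \<le> real (min i m) * (real k * (real k - c))"
  proof (cases "i \<le> m")
    case True
    \<comment> \<open>This product is the difference of the two denominators. Its second factor may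
      be negative only for \<open>m = k\<close>, where the first vanishes: for \<open>m < k\<close>
      integrality gives \<open>k - m \<ge> 1 > c\<close>.\<close>
    have "0 \<le> (real k - real m) * (real k - real m - c)"
      using assms by (cases "m = k") (auto intro!: mult_nonneg_nonneg)
    then have "real m * (2 * real k - real m - c) \<le> real k * (real k - c)"
      by (simp add: algebra_simps)
    then show ?thesis
      using True by (simp add: mult_left_mono)
  next
    case False
    \<comment> \<open>Here \<open>min i m = m\<close> cancels. The factors are bounded by
      \<open>2 * i \<le> k\<close> and \<open>m \<ge> 1\<close>.\<close>
    have "real i * (2 * real k - real m - c) \<le> real k / 2 * (2 * real k - 1 - c)"
      using assms by (intro mult_mono) auto
    also have "\<dots> \<le> real k * (real k - c)"
    proof -
      \<comment> \<open>Half of this is the gap between the two sides.\<close>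
      have "0 \<le> real k * (1 - c)"
        using assms by simp
      then show ?thesis
        by (simp add: algebra_simps)
    qed
    finally have "real m * (real i * (2 * real k - real m - c)) \<le> real m * (real k * (real k - c))"
      by (rule mult_left_mono) simp
    then show ?thesis
      using False by (simp add: min_def algebra_simps)
  qed
  then show ?thesis
    using pos by (simp add: divide_le_eq le_divide_eq mult.commute)
qed

theorem theorem10:
  fixes n :: nat
  assumes "n \<ge> 3" and "odd n"
  shows "\<forall>\<mu>\<in>W n. (n + 1) div 2 \<in> I_set n \<mu> \<inter> I'_set n \<mu>"
proof
  fix \<mu> assume "\<mu> \<in> W n"
  then obtain i where i: "i \<in> {1..(n + 1) div 4}"
    and \<mu>: "\<mu> = (\<lambda>H. fund_weight i H + fund_weight (n + 1 - i) H)"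
    by (auto simp: W_def)
  define k where "k = (n + 1) div 2"
  have nk: "n + 1 = 2 * k" and k: "k \<in> {1..n}"
    using assms by (auto simp: k_def)
  \<comment> \<open>The range of i in \<open>W\<close> amounts to exactly this bound.\<close>
  have ik: "2 * i \<le> k"
    using i by (auto simp: k_def)
  define m where "m j = min j (n + 1 - j)" for j
  have mk: "m k = k"
    using nk by (simp add: m_def)
  have m: "1 \<le> m j" "m j \<le> k" if "j \<in> {1..n}" for j
    using that nk by (auto simp: m_def)
  have \<mu>m: "\<mu> (beta n j) = real (min i (m j))" if "j \<in> {1..n}" for j
    using fund_weight_pair_beta[OF that, of i] ik nk by (simp add: \<mu> m_def)
  \<comment> \<open>The summand \<open>- 0\<close> gives the shape of \<open>minimal\<close> with
    \<open>c = 0\<close>; \<open>psi\<close> below is the case \<open>c = 1 / 2\<close>, as \<gamma>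
    contributes \<open>m j / 2\<close>.\<close>
  have rho: "2 * rho n (beta n j) = real (m j) * (2 * real k - real (m j) - 0)"
    if "j \<in> {1..n}" for j
  proof -
    have "real (n + 1) = 2 * real k"
      using nk by simp
    then show ?thesis
      unfolding rho_beta[OF that] using that by (auto simp: m_def min_def of_nat_diff)
  qed
  have psi: "psi n (beta n j) = real (m j) * (2 * real k - real (m j) - 1 / 2)"
    if "j \<in> {1..n}" for j
    using rho[OF that] gamma_beta[OF that] by (simp add: psi_def m_def algebra_simps)
  have minimal: "f k = Min (f ` {1..n})"
    if f: "\<And>j. j \<in> {1..n} \<Longrightarrow> f j = real (min i (m j)) / (real (m j) * (2 * real k - real (m j) - c))"
      and c: "0 \<le> c" "c < 1" for f :: "nat \<Rightarrow> real" and c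
  proof (rule Min_eqI[symmetric])
    fix y assume "y \<in> f ` {1..n}"
    then obtain j where j: "j \<in> {1..n}" and y: "y = f j"
      by blast
    have "f k = real i / (real k * (real k - c))"
      using f[OF k] mk ik by (simp add: min_def)
    then show "f k \<le> y"
      using ratio_min[OF m[OF j] ik c] f[OF j] y by simp
  qed (use k in auto)
  have "k \<in> I_set n \<mu>"
    unfolding I_set_def using k minimal[of _ 0] \<mu>m rho by simp
  moreover have "k \<in> I'_set n \<mu>"
    unfolding I'_set_def using k minimal[of _ "1 / 2"] \<mu>m psi by simp
  ultimately show "(n + 1) div 2 \<in> I_set n \<mu> \<inter> I'_set n \<mu>"
    by (simp add: k_def)
qed

end
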